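(* On $\ell_1$ there is no non-trivial Fréchet differentiable bump; that is, there is no function $b:\ell_1\to\mathbb{R}$, not identically zero and with bounded support, that is Fréchet differentiable at every point of $\ell_1$.
   Context: $\ell_1$ is the real Banach space of absolutely summable real sequences with norm $\|x\|=\sum_n|x_n|$. A bump on a Banach space is a real-valued function on it with bounded support (the set where it is nonzero is bounded); it is non-trivial if it is not identically zero. *)

theory Defs
  imports "HOL-Analysis.Analysis"
begin

text \<open>
  The distribution has no sequence spaces, so \<open>\<ell>\<^sub>1\<close> is introduced as a type and made an
  instance of \<^class>\<open>banach\<close>. Frechet differentiability at a point is then the library's
  \<^const>\<open>differentiable\<close>, whose derivative is a bounded linear map.
\<close>

typedef l1 = "{x :: nat \<Rightarrow> real. summable (\<lambda>n. \<bar>x n\<bar>)}"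
  morphisms l1_nth Abs_l1
  by (intro exI[of _ "\<lambda>_. 0"]) simp

setup_lifting type_definition_l1

lemma summable_l1_nth: "summable (\<lambda>n. \<bar>l1_nth x n\<bar>)"
  using l1_nth[of x] by simp

lemma l1_eqI: "(\<And>n. l1_nth x n = l1_nth y n) \<Longrightarrow> x = y"
  by (simp add: l1_nth_inject[symmetric] ext)

instantiation l1 :: real_vector
begin

lift_definition zero_l1 :: l1 is "\<lambda>_. 0" by simp

lift_definition plus_l1 :: "l1 \<Rightarrow> l1 \<Rightarrow> l1" is "\<lambda>x y n. x n + y n"
proof -
  fix x y :: "nat \<Rightarrow> real"
  assume "summable (\<lambda>n. \<bar>x n\<bar>)" "summable (\<lambda>n. \<bar>y n\<bar>)"
  from summable_add[OF this] show "summable (\<lambda>n. \<bar>x n + y n\<bar>)"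
    by (rule summable_comparison_test'[where N = 0]) (simp add: abs_triangle_ineq)
qed

lift_definition minus_l1 :: "l1 \<Rightarrow> l1 \<Rightarrow> l1" is "\<lambda>x y n. x n - y n"
proof -
  fix x y :: "nat \<Rightarrow> real"
  assume "summable (\<lambda>n. \<bar>x n\<bar>)" "summable (\<lambda>n. \<bar>y n\<bar>)"
  from summable_add[OF this] show "summable (\<lambda>n. \<bar>x n - y n\<bar>)"
    by (rule summable_comparison_test'[where N = 0]) (simp add: abs_triangle_ineq4)
qed

lift_definition uminus_l1 :: "l1 \<Rightarrow> l1" is "\<lambda>x n. - x n" by simp

lift_definition scaleR_l1 :: "real \<Rightarrow> l1 \<Rightarrow> l1" is "\<lambda>c x n. c * x n"
  by (simp add: abs_mult summable_mult)

instance
  by standard (transfer; simp add: fun_eq_iff algebra_simps)+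

end

lemmas l1_nth_simps = zero_l1.rep_eq plus_l1.rep_eq minus_l1.rep_eq uminus_l1.rep_eq scaleR_l1.rep_eq

instantiation l1 :: real_normed_vector
begin

definition norm_l1 :: "l1 \<Rightarrow> real"
  where "norm_l1 x = (\<Sum>n. \<bar>l1_nth x n\<bar>)"

definition dist_l1 :: "l1 \<Rightarrow> l1 \<Rightarrow> real"
  where "dist_l1 x y = norm (x - y)"

definition sgn_l1 :: "l1 \<Rightarrow> l1"
  where "sgn_l1 x = x /\<^sub>R norm x"

definition uniformity_l1 :: "(l1 \<times> l1) filter"
  where "uniformity_l1 = (INF e\<in>{0<..}. principal {(x, y). dist x y < e})"

definition open_l1 :: "l1 set \<Rightarrow> bool"
  where "open_l1 U = (\<forall>x\<in>U. \<forall>\<^sub>F (x', y) in uniformity. x' = x \<longrightarrow> y \<in> U)"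

instance
proof
  fix x y :: l1 and c :: real
  show "norm x = 0 \<longleftrightarrow> x = 0"
    by (auto simp: norm_l1_def suminf_eq_zero_iff[OF summable_l1_nth] l1_nth_simps intro!: l1_eqI)
  show "norm (x + y) \<le> norm x + norm y"
    unfolding norm_l1_def suminf_add[OF summable_l1_nth summable_l1_nth]
    by (intro suminf_le summable_add summable_l1_nth) (simp add: l1_nth_simps abs_triangle_ineq)
  show "norm (c *\<^sub>R x) = \<bar>c\<bar> * norm x"
    by (simp add: norm_l1_def l1_nth_simps abs_mult suminf_mult summable_l1_nth)
qed (simp_all add: dist_l1_def sgn_l1_def uniformity_l1_def open_l1_def)

end

lemma sum_le_norm_l1: "(\<Sum>n<N. \<bar>l1_nth x n\<bar>) \<le> norm x"
  unfolding norm_l1_def by (intro sum_le_suminf summable_l1_nth) auto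

lemma abs_l1_nth_le_norm: "\<bar>l1_nth x n\<bar> \<le> norm x"
proof -
  have "\<bar>l1_nth x n\<bar> \<le> (\<Sum>i<Suc n. \<bar>l1_nth x i\<bar>)"
    by (rule member_le_sum) auto
  also have "\<dots> \<le> norm x"
    by (rule sum_le_norm_l1)
  finally show ?thesis .
qed

instance l1 :: banach
proof
  fix X :: "nat \<Rightarrow> l1"
  assume X: "Cauchy X"
  have "Cauchy (\<lambda>k. l1_nth (X k) n)" for n
  proof (rule metric_CauchyI)
    fix e :: real assume "e > 0"
    then obtain M where M: "\<And>k m. k \<ge> M \<Longrightarrow> m \<ge> M \<Longrightarrow> dist (X k) (X m) < e"
      using metric_CauchyD[OF X] by blast
    have "dist (l1_nth (X k) n) (l1_nth (X m) n) < e" if "k \<ge> M" "m \<ge> M" for k m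
      using abs_l1_nth_le_norm[of "X k - X m" n] M[OF that]
      by (simp add: dist_norm l1_nth_simps)
    then show "\<exists>M. \<forall>k\<ge>M. \<forall>m\<ge>M. dist (l1_nth (X k) n) (l1_nth (X m) n) < e" by blast
  qed
  then have "\<forall>n. \<exists>l. (\<lambda>k. l1_nth (X k) n) \<longlonglongrightarrow> l"
    by (simp add: Cauchy_convergent_iff convergent_def)
  then obtain x where x: "\<And>n. (\<lambda>k. l1_nth (X k) n) \<longlonglongrightarrow> x n"
    by metis
  have bnd: "\<exists>M. \<forall>m\<ge>M. \<forall>N. (\<Sum>n<N. \<bar>l1_nth (X m) n - x n\<bar>) \<le> e" if "e > 0" for e
  proof -
    obtain M where M: "\<And>k m. k \<ge> M \<Longrightarrow> m \<ge> M \<Longrightarrow> dist (X k) (X m) < e"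
      using metric_CauchyD[OF X \<open>e > 0\<close>] by blast
    have "(\<Sum>n<N. \<bar>l1_nth (X m) n - x n\<bar>) \<le> e" if "m \<ge> M" for m N
    proof (rule tendsto_upperbound)
      show "(\<lambda>k. \<Sum>n<N. \<bar>l1_nth (X m) n - l1_nth (X k) n\<bar>)
              \<longlonglongrightarrow> (\<Sum>n<N. \<bar>l1_nth (X m) n - x n\<bar>)"
        by (intro tendsto_intros x)
      have "(\<Sum>n<N. \<bar>l1_nth (X m) n - l1_nth (X k) n\<bar>) \<le> e" if "k \<ge> M" for k
        using sum_le_norm_l1[of "X m - X k" N] M[OF \<open>m \<ge> M\<close> that]
        by (simp add: dist_norm l1_nth_simps)
      then show "\<forall>\<^sub>F k in sequentially. (\<Sum>n<N. \<bar>l1_nth (X m) n - l1_nth (X k) n\<bar>) \<le> e"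
        by (auto simp: eventually_sequentially)
    qed simp
    then show ?thesis by blast
  qed
  have diff: "summable (\<lambda>n. \<bar>l1_nth (X m) n - x n\<bar>)"
    if "\<forall>N. (\<Sum>n<N. \<bar>l1_nth (X m) n - x n\<bar>) \<le> e" for m e
    using that by (intro summableI_nonneg_bounded) auto
  obtain m where m: "\<forall>N. (\<Sum>n<N. \<bar>l1_nth (X m) n - x n\<bar>) \<le> 1"
    using bnd[of 1] by auto
  have "summable (\<lambda>n. \<bar>x n\<bar>)"
    by (rule summable_comparison_test'[OF summable_add[OF summable_l1_nth[of "X m"] diff[OF m]]]) simp
  then have L: "l1_nth (Abs_l1 x) = x"
    by (simp add: Abs_l1_inverse)
  have "X \<longlonglongrightarrow> Abs_l1 x"
  proof (rule metric_LIMSEQ_I)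
    fix e :: real assume "e > 0"
    then obtain M where M: "\<forall>m\<ge>M. \<forall>N. (\<Sum>n<N. \<bar>l1_nth (X m) n - x n\<bar>) \<le> e / 2"
      using bnd[of "e / 2"] by auto
    have "dist (X m) (Abs_l1 x) < e" if "m \<ge> M" for m
    proof -
      have "norm (X m - Abs_l1 x) \<le> e / 2"
        using M that diff unfolding norm_l1_def l1_nth_simps L
        by (intro suminf_le_const) blast+
      then show ?thesis
        using \<open>e > 0\<close> by (simp add: dist_norm)
    qed
    then show "\<exists>M. \<forall>m\<ge>M. dist (X m) (Abs_l1 x) < e" by blast
  qed
  then show "convergent X"
    by (auto simp: convergent_def)
qed

text \<open>The support is the set where the function is nonzero, without taking the closure.\<close>

definition bump :: "('a::real_normed_vector \<Rightarrow> real) \<Rightarrow> bool"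
  where "bump b \<longleftrightarrow> bounded {x. b x \<noteq> 0}"

definition nontrivial_bump :: "('a::real_normed_vector \<Rightarrow> real) \<Rightarrow> bool"
  where "nontrivial_bump b \<longleftrightarrow> bump b \<and> (\<exists>x. b x \<noteq> 0)"

end

theory Submission
  imports Defs
begin

text \<open>
  The norm of \<open>\<ell>\<^sub>1\<close> is rough: at every point it has a corner, of a fixed size, in
  arbitrarily short directions \<open>t e\<^sub>n\<close>. For a differentiable bump \<open>b\<close>, Ekeland's variational
  principle gives a point inside the support at which a multiple of \<open>1 / (1 + b\<^sup>2)\<close> minus
  the norm has an approximate minimum. There the smooth function lies above the norm up to a
  small slope, so it inherits the corner, which contradicts differentiability.
\<close>

text \<open>Greedy descent in the partial order where \<open>y\<close> is below \<open>x\<close> iff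
  \<open>y \<in> S x\<close>. The closed lower sets of successive near-minimisers shrink to a single
  point by completeness, and that point is minimal in the order.\<close>

theorem ekeland_variational_principle:
  fixes f :: "'a::complete_space \<Rightarrow> real"
  assumes cont: "continuous_on UNIV f" and bdd: "bdd_below (range f)" and e: "e > 0"
  obtains x where "f x + e * dist a x \<le> f a" "\<And>y. y \<noteq> x \<Longrightarrow> f x < f y + e * dist x y"
proof -
  define S where "S x = {y. f y + e * dist x y \<le> f x}" for x
  have self: "x \<in> S x" for x
    by (simp add: S_def)
  have S_mono: "S y \<subseteq> S x" if "y \<in> S x" for x y
  proof
    fix z assume "z \<in> S y"
    moreover have "e * dist x z \<le> e * dist x y + e * dist y z"
      using e dist_triangle[of x z y] by (simp add: distrib_left[symmetric])
    ultimately show "z \<in> S x"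
      using that by (simp add: S_def)
  qed
  have closed_S: "closed (S x)" for x
    unfolding S_def by (intro closed_Collect_le continuous_intros cont)
  have bdd_S: "bdd_below (f ` S x)" for x
    by (rule bdd_below_mono[OF bdd]) auto
  have "\<exists>y. y \<in> S x \<and> f y < Inf (f ` S x) + 1 / Suc n" for n x
    using cInf_lessD[of "f ` S x" "Inf (f ` S x) + 1 / Suc n"] self[of x] by auto
  then have "\<forall>n. \<exists>F. \<forall>x. F x \<in> S x \<and> f (F x) < Inf (f ` S x) + 1 / Suc n"
    by (intro allI choice)
  from choice[OF this] obtain next_pt where "\<forall>n x. next_pt n x \<in> S x \<and>
      f (next_pt n x) < Inf (f ` S x) + 1 / Suc n" ..
  then have next_pt: "next_pt n x \<in> S x" "f (next_pt n x) < Inf (f ` S x) + 1 / Suc n" for n x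
    by blast+
  define X where "X = rec_nat a next_pt"
  have X_Suc: "X (Suc n) = next_pt n (X n)" for n
    by (simp add: X_def)
  have step: "S (X (Suc n)) \<subseteq> S (X n)" for n
    unfolding X_Suc by (intro S_mono next_pt)
  \<comment> \<open>\<open>X (Suc n)\<close> is within \<open>1 / Suc n\<close> of the infimum of
    \<open>f\<close> over \<open>S (X n)\<close>, so the points below it leave \<open>f\<close>
    almost no room to drop, and each unit of distance costs a drop of \<open>e\<close>.\<close>
  have small: "e * dist (X (Suc n)) y < 1 / Suc n" if "y \<in> S (X (Suc n))" for n y
  proof -
    have "Inf (f ` S (X n)) \<le> f y"
      using that step by (intro cInf_lower bdd_S) auto
    then show ?thesis
      using that next_pt(2)[of n "X n"] by (simp add: S_def X_Suc)
  qed
  have tiny: "\<exists>n. \<forall>y\<in>S (X n). dist (X n) y < d" if d: "d > 0" for d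
  proof -
    obtain n where n: "1 / Suc n < e * d"
      using nat_approx_posE[of "e * d"] mult_pos_pos[OF e d] by blast
    have "dist (X (Suc n)) y < d" if "y \<in> S (X (Suc n))" for y
      using small[OF that] n e by (smt (verit) mult_less_cancel_left_pos)
    then show ?thesis by blast
  qed
  obtain x where x: "\<And>n. x \<in> S (X n)"
  proof (rule decreasing_closed_nest[of "\<lambda>n. S (X n)"])
    show "S (X n) \<subseteq> S (X m)" if "m \<le> n" for m n
      using lift_Suc_antimono_le[of "\<lambda>n. S (X n)", OF step that] .
    show "\<exists>n. \<forall>y\<in>S (X n). \<forall>z\<in>S (X n). dist y z < d" if "d > 0" for d
      using tiny[of "d / 2"] that by (metis dist_triangle_half_r half_gt_zero)
  qed (use closed_S self in auto)
  show ?thesis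
  proof (rule that)
    show "f x + e * dist a x \<le> f a"
      using x[of 0] by (simp add: S_def X_def)
    fix y assume "y \<noteq> x"
    show "f x < f y + e * dist x y"
    proof (rule ccontr)
      assume "\<not> ?thesis"
      then have "y \<in> S x"
        by (simp add: S_def)
      \<comment> \<open>A point below \<open>x\<close> lies in all the nested sets, whose only
        common point is \<open>x\<close>.\<close>
      then have "y \<in> S (X n)" for n
        using S_mono[OF x] by blast
      moreover obtain n where "\<forall>z\<in>S (X n). dist (X n) z < dist x y / 2"
        using tiny[of "dist x y / 2"] \<open>y \<noteq> x\<close> by auto
      ultimately show False
        using x[of n] dist_triangle_half_r[of "X n" x "dist x y" y] by auto
    qed
  qed
qed

text \<open>The symmetric second difference measures the corner; its size \<open>r\<close> is
  uniform in \<open>x\<close>.\<close>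

definition rough_norm :: "'a::real_normed_vector itself \<Rightarrow> bool"
  where "rough_norm _ \<longleftrightarrow> (\<exists>r>0. \<forall>x::'a. \<forall>d>0. \<exists>h. 0 < norm h \<and> norm h < d \<and>
           r * norm h \<le> norm (x + h) + norm (x - h) - 2 * norm x)"

theorem rough_norm_no_differentiable_bump:
  fixes b :: "'a::banach \<Rightarrow> real"
  assumes rough: "rough_norm TYPE('a)"
    and bump: "nontrivial_bump b"
    and diff: "\<And>x. b differentiable (at x)"
  shows False
proof -
  obtain r where "r > 0" and r: "\<And>(x::'a) d. d > 0 \<Longrightarrow> \<exists>h. 0 < norm h \<and> norm h < d \<and>
      r * norm h \<le> norm (x + h) + norm (x - h) - 2 * norm x"
    using rough unfolding rough_norm_def by blast
  obtain R where "R > 0" and R: "\<And>x. b x \<noteq> 0 \<Longrightarrow> norm x < R"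
    using bump unfolding nontrivial_bump_def bump_def bounded_pos_less by auto
  obtain a where a: "b a \<noteq> 0"
    using bump by (auto simp: nontrivial_bump_def)
  \<comment> \<open>Differentiable, positive, and equal to 1 exactly where \<open>b\<close>
    vanishes.\<close>
  define \<psi> where "\<psi> x = inverse (1 + (b x)\<^sup>2)" for x
  have nz: "1 + (b x)\<^sup>2 \<noteq> 0" for x
    using zero_le_power2[of "b x"] by linarith
  have "\<psi> a < 1"
    using a by (simp add: \<psi>_def inverse_less_1_iff add_pos_nonneg)
  \<comment> \<open>The constant makes \<open>f a\<close> below smaller than every value of \<open>f\<close> outside the support of \<open>b\<close>.\<close>
  define K where "K = (R + 1) / (1 - \<psi> a)"
  have "K > 0"
    using \<open>R > 0\<close> \<open>\<psi> a < 1\<close> by (simp add: K_def)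
  define g where "g x = K * \<psi> x" for x
  have g_diff: "g differentiable (at x)" for x
    unfolding g_def \<psi>_def by (intro derivative_intros diff nz)
  \<comment> \<open>Truncation at \<open>R\<close> keeps \<open>f\<close> bounded below and changes
    nothing on the ball containing the support.\<close>
  define f where "f x = g x - min (norm x) R" for x
  have "continuous_on UNIV g"
    using g_diff by (simp add: continuous_at_imp_continuous_on differentiable_imp_continuous_within)
  then have "continuous_on UNIV f"
    unfolding f_def by (intro continuous_intros)
  moreover have "- R \<le> f x" for x
  proof -
    have "0 \<le> g x"
      using \<open>K > 0\<close> by (simp add: g_def \<psi>_def)
    then show ?thesis by (simp add: f_def)
  qed
  then have "bdd_below (range f)"
    by (auto intro!: bdd_belowI[of _ "- R"])
  ultimately obtain x where fx: "f x + r / 4 * dist a x \<le> f a"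
    and ek: "\<And>y. y \<noteq> x \<Longrightarrow> f x < f y + r / 4 * dist x y"
    using ekeland_variational_principle[of f "r / 4" a] \<open>r > 0\<close> by auto
  \<comment> \<open>Where \<open>b\<close> vanishes, \<open>f\<close> is at least
    \<open>K - R\<close>, so a point with \<open>f x \<le> f a\<close> must lie in the
    support.\<close>
  have "f a < K - R"
  proof -
    have "K * (1 - \<psi> a) = R + 1"
      using \<open>\<psi> a < 1\<close> by (simp add: K_def)
    then show ?thesis
      using R[OF a] norm_ge_zero[of a] unfolding f_def g_def right_diff_distrib by linarith
  qed
  moreover have "f x \<le> f a"
    using fx \<open>r > 0\<close> zero_le_dist[of a x] by (smt (verit) divide_nonneg_nonneg mult_nonneg_nonneg)
  ultimately have "b x \<noteq> 0"
    by (auto simp: f_def g_def \<psi>_def)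
  then have "norm x < R"
    by (rule R)
  obtain D where D: "(g has_derivative D) (at x)"
    using g_diff unfolding differentiable_def by blast
  then interpret bounded_linear D
    by (rule has_derivative_bounded_linear)
  obtain d where "d > 0"
    and d: "\<And>y. norm (y - x) < d \<Longrightarrow> norm (g y - g x - D (y - x)) \<le> r / 8 * norm (y - x)"
    using D \<open>r > 0\<close> unfolding has_derivative_at_alt by (metis divide_pos_pos zero_less_numeral)
  obtain h where h: "0 < norm h" "norm h < d" "norm h < R - norm x"
    and corner: "r * norm h \<le> norm (x + h) + norm (x - h) - 2 * norm x"
    using r[of "min d (R - norm x)" x] \<open>d > 0\<close> \<open>norm x < R\<close> by auto
  \<comment> \<open>The linear terms at \<open>h\<close> and \<open>- h\<close> cancel, leaving two
    errors of \<open>r / 8\<close>.\<close>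
  have gh: "g (x + h) + g (x - h) - 2 * g x \<le> r / 4 * norm h"
    using d[of "x + h"] d[of "x - h"] h(2) by (simp add: neg abs_if split: if_splits)
  have "f x < f (x + h) + r / 4 * norm h" "f x < f (x - h) + r / 4 * norm h"
    using ek[of "x + h"] ek[of "x - h"] h(1) by (auto simp: dist_norm)
  moreover have "f y = g y - norm y" if "norm y < R" for y
    using that by (simp add: f_def)
  moreover have "norm (x + h) < R" "norm (x - h) < R"
    using norm_triangle_ineq[of x h] norm_triangle_ineq4[of x h] h(3) by linarith+
  \<comment> \<open>Adding the two Ekeland inequalities to the corner bounds the second difference
    of \<open>g\<close> below by \<open>(r - 2 * (r / 4)) * norm h\<close>, twice the upper bound
    \<open>gh\<close>.\<close>
  ultimately show False
    using gh corner \<open>norm x < R\<close> mult_pos_pos[OF \<open>r > 0\<close> h(1)] by simp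
qed

lift_definition l1_single :: "nat \<Rightarrow> real \<Rightarrow> l1" is "\<lambda>n t (i::nat). if i = n then t else 0"
proof -
  fix n :: nat and t :: real
  have "(\<lambda>i. \<bar>if i = n then t else 0\<bar>) = (\<lambda>i. if i = n then \<bar>t\<bar> else 0)"
    by auto
  then show "summable (\<lambda>i. \<bar>if i = n then t else 0\<bar>)"
    by simp
qed

text \<open>Reduces the corner to a computation in one real variable.\<close>

lemma norm_add_l1_single:
  "norm (x + l1_single n t) = norm x - \<bar>l1_nth x n\<bar> + \<bar>l1_nth x n + t\<bar>"
proof -
  have "(\<lambda>i. \<bar>l1_nth (x + l1_single n t) i\<bar> - \<bar>l1_nth x i\<bar>) =
      (\<lambda>i. if i = n then \<bar>l1_nth x i + t\<bar> - \<bar>l1_nth x i\<bar> else 0)"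
    by (auto simp: l1_nth_simps l1_single.rep_eq)
  then have "norm (x + l1_single n t) - norm x = \<bar>l1_nth x n + t\<bar> - \<bar>l1_nth x n\<bar>"
    unfolding norm_l1_def suminf_diff[OF summable_l1_nth summable_l1_nth]
    using sums_unique[OF sums_single[of n "\<lambda>i. \<bar>l1_nth x i + t\<bar> - \<bar>l1_nth x i\<bar>"]] by simp
  then show ?thesis by simp
qed

lemma norm_l1_single: "norm (l1_single n t) = \<bar>t\<bar>"
  using norm_add_l1_single[of 0 n t] by (simp add: l1_nth_simps)

lemma uminus_l1_single: "- l1_single n t = l1_single n (- t)"
  by (rule l1_eqI) (simp add: l1_nth_simps l1_single.rep_eq)

text \<open>Coordinates tend to 0, so some \<open>n\<close> has a coordinate below
  \<open>t / 2\<close> in absolute value. Moving it by \<open>t\<close> both ways gives second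
  difference \<open>2 * t - 2 * \<bar>l1_nth x n\<bar>\<close>, which exceeds \<open>t\<close>;
  hence \<open>r = 1\<close> works.\<close>

lemma rough_norm_l1: "rough_norm TYPE(l1)"
  unfolding rough_norm_def
proof (intro exI[of _ 1] conjI allI impI)
  fix x :: l1 and d :: real assume "d > 0"
  define t where "t = d / 2"
  have t: "0 < t" "t < d"
    using \<open>d > 0\<close> by (simp_all add: t_def)
  obtain n where n: "\<bar>l1_nth x n\<bar> < t / 2"
    using LIMSEQ_D[OF summable_LIMSEQ_zero[OF summable_l1_nth[of x]], of "t / 2"] t by auto
  have "norm (x - l1_single n t) = norm x - \<bar>l1_nth x n\<bar> + \<bar>l1_nth x n - t\<bar>"
    using norm_add_l1_single[of x n "- t"] by (simp add: uminus_l1_single[symmetric])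
  then show "\<exists>h. 0 < norm h \<and> norm h < d \<and>
      1 * norm h \<le> norm (x + h) + norm (x - h) - 2 * norm x"
    using t n by (intro exI[of _ "l1_single n t"]) (simp add: norm_add_l1_single norm_l1_single)
qed simp

theorem proposition5p1:
  shows "\<not> (\<exists>b :: l1 \<Rightarrow> real. nontrivial_bump b \<and> (\<forall>x. b differentiable (at x)))"
  using rough_norm_no_differentiable_bump[OF rough_norm_l1] by blast

end
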